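(* Let $k\in\mathbb{N}$, let $\lambda\in\mathbb{T}$, and let $(X,T)$, $X=\mathbb{T}^k$, be the Milnes type skew product dynamical system with base group $G=\mathbb{T}$ and $\gamma_0=\lambda$. Let $f:\mathbb{Z}\to\mathbb{T}$, $f(n)=\lambda^{n^k}$, and let $\Gamma:X\to\mathbb{T}^{\mathbb{Z}}$ be defined by $$\Gamma(x_1,x_2,\ldots,x_k)(n)=f(n)\,x_1^{n^{k-1}}x_2^{n^{k-2}}\cdots x_{k-1}^{n}x_k\qquad((x_1,\ldots,x_k)\in X,\ n\in\mathbb{Z}).$$ If $\lambda$ is irrational, then $\mathrm{Range}(\Gamma)=X_f$, and $\Gamma:(X,T)\to(X_f,V)$ is a homomorphism, that is, $V\Gamma=\Gamma T$, and so $X_f$ is a factor of $\mathbb{T}^k$.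
   Context: $\mathbb{T}$ is the unit circle, written multiplicatively; $\lambda\in\mathbb{T}$ is called irrational if it is not a root of unity. Milnes type system on $\mathbb{T}^k$ with generator $\lambda$: $T:\mathbb{T}^k\to\mathbb{T}^k$ is the homeomorphism $T(x_1,\ldots,x_k)=(y_1,\ldots,y_k)$ with $$y_i=\lambda^{\binom{k}{i}}\prod_{j=1}^{i}x_j^{\binom{k-j}{i-j}}\qquad(i=1,\ldots,k).$$ $V:l^\infty(\mathbb{Z})\to l^\infty(\mathbb{Z})$ is the shift operator $V(g)(n)=g(n+1)$. For $f\in l^\infty(\mathbb{Z})$, $X_f$ is the closure of $\{V^n(f):n\in\mathbb{Z}\}$ in $l^\infty(\mathbb{Z})$ in the topology of pointwise convergence on $\mathbb{Z}$; $X_f$ is compact in this topology, and the restriction of $V$ to $X_f$ (again denoted $V$) makes $(X_f,V)$ a dynamical system. A dynamical system $(Y,S)$ is a factor of $(X,T)$ if there is a continuous surjection $\pi:X\to Y$ with $S\pi=\pi T$. *)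

theory Defs
  imports "HOL-Analysis.Analysis"
begin

abbreviation circle :: "complex set" where
  "circle \<equiv> sphere 0 1"

definition irrational :: "complex \<Rightarrow> bool" where
  "irrational lam \<longleftrightarrow> (\<forall>m::nat. 0 < m \<longrightarrow> lam ^ m \<noteq> 1)"

definition dynamical_system :: "'a topology \<Rightarrow> ('a \<Rightarrow> 'a) \<Rightarrow> bool" where
  "dynamical_system X T \<longleftrightarrow>
     compact_space X \<and> Hausdorff_space X \<and> homeomorphic_map X X T"

definition dyn_homomorphism ::
  "'a topology \<Rightarrow> ('a \<Rightarrow> 'a) \<Rightarrow> 'b topology \<Rightarrow> ('b \<Rightarrow> 'b) \<Rightarrow> ('a \<Rightarrow> 'b) \<Rightarrow> bool" where
  "dyn_homomorphism X T Y S p \<longleftrightarrow>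
     dynamical_system X T \<and> dynamical_system Y S \<and>
     continuous_map X Y p \<and> (\<forall>x\<in>topspace X. S (p x) = p (T x))"

definition is_factor ::
  "'b topology \<Rightarrow> ('b \<Rightarrow> 'b) \<Rightarrow> 'a topology \<Rightarrow> ('a \<Rightarrow> 'a) \<Rightarrow> bool" where
  "is_factor Y S X T \<longleftrightarrow>
     (\<exists>p. dyn_homomorphism X T Y S p \<and> p ` topspace X = topspace Y)"

text \<open>Points of the \<open>k\<close>-torus are functions on the index set \<open>{1..k}\<close>, extended by
  \<open>undefined\<close> outside it, so that \<open>k\<close> can be an ordinary natural number.\<close>

definition torus :: "nat \<Rightarrow> (nat \<Rightarrow> complex) topology" where
  "torus k = product_topology (\<lambda>_. top_of_set circle) {1..k}"

definition milnes_map :: "nat \<Rightarrow> complex \<Rightarrow> (nat \<Rightarrow> complex) \<Rightarrow> (nat \<Rightarrow> complex)" where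
  "milnes_map k lam x =
     (\<lambda>i\<in>{1..k}. lam ^ (k choose i) * (\<Prod>j = 1..i. x j ^ ((k - j) choose (i - j))))"

definition linf :: "(int \<Rightarrow> complex) set" where
  "linf = {g. bounded (range g)}"

definition shift :: "(int \<Rightarrow> complex) \<Rightarrow> (int \<Rightarrow> complex)" where
  "shift g = (\<lambda>n. g (n + 1))"

definition int_iterate :: "('a \<Rightarrow> 'a) \<Rightarrow> int \<Rightarrow> 'a \<Rightarrow> 'a" where
  "int_iterate S n = (if 0 \<le> n then S ^^ nat n else inv S ^^ nat (- n))"

text \<open>The library topology on \<open>int \<Rightarrow> complex\<close> is the product topology, i.e. the topology of
  pointwise convergence; the closure is taken relative to \<open>linf\<close>.\<close>

definition orbit_closure :: "(int \<Rightarrow> complex) \<Rightarrow> (int \<Rightarrow> complex) set" where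
  "orbit_closure f = top_of_set linf closure_of {int_iterate shift n f |n. True}"

definition power_fun :: "nat \<Rightarrow> complex \<Rightarrow> int \<Rightarrow> complex" where
  "power_fun k lam n = lam powi (n ^ k)"

definition Gamma_map :: "nat \<Rightarrow> complex \<Rightarrow> (nat \<Rightarrow> complex) \<Rightarrow> (int \<Rightarrow> complex)" where
  "Gamma_map k lam x = (\<lambda>n. power_fun k lam n * (\<Prod>j = 1..k. x j powi (n ^ (k - j))))"

end

theory Submission
  imports Defs "HOL-Computational_Algebra.Polynomial" "HOL-Real_Asymp.Real_Asymp"
begin

text \<open>
  Write \<open>T\<close> for \<open>milnes_map k lam\<close>, \<open>\<Gamma>\<close> for \<open>Gamma_map k lam\<close>, \<open>f\<close> for \<open>power_fun k lam\<close> and \<open>V\<close> for the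
  shift. The identity \<open>V \<Gamma> = \<Gamma> T\<close> is the binomial theorem (\<open>shift_Gamma_map\<close>). The binomial theorem
  also shows that \<open>V\<^sup>n f\<close> is the image under \<open>\<Gamma>\<close> of the point with the coordinates
  \<open>lam powi ((k choose j) * n ^ j)\<close>, which is the \<open>n\<close>-th point of the orbit of \<open>(1, \<dots>, 1)\<close> under \<open>T\<close>
  (\<open>Gamma_map_orbit_point\<close>). Since \<open>\<Gamma>\<close> is continuous and the torus is compact, the range of \<open>\<Gamma>\<close> is the
  closure of the shift orbit of \<open>f\<close> as soon as this one orbit is dense in the torus. That density is
  the heart of the matter and the only place where the irrationality of \<open>lam\<close> enters.

  Density rests on Weyl's theorem: the averages of \<open>lam powi p n\<close> over \<open>n < N\<close> tend to \<open>0\<close> for every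
  nonconstant integer polynomial \<open>p\<close> (\<open>Weyl_polynomial_sum\<close>). It follows by induction on the degree
  from van der Corput's lemma (\<open>van_der_Corput\<close>). Along the orbit every nontrivial character of the
  torus has this form, because \<open>n, n\<^sup>2, \<dots>, n ^ k\<close> are linearly independent modulo constants. So all
  nontrivial characters have mean \<open>0\<close> along the orbit, and a nonnegative trigonometric polynomial
  concentrated near a given point shows that the orbit comes arbitrarily close to that point
  (\<open>dense_if_character_means_vanish\<close>).

  Finally, \<open>T\<close> is bijective because it is triangular in the coordinates, and the shift is bijective
  on the orbit closure because \<open>\<Gamma>\<close> carries the surjectivity of \<open>T\<close> over. A continuous bijection of a
  compact Hausdorff space is a homeomorphism, so both are dynamical systems.
\<close>

section \<open>Exponential sums along integer polynomials\<close>

lemma norm_diff_shifted_sum_le: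
  fixes u :: "nat \<Rightarrow> complex"
  assumes "\<And>n. norm (u n) \<le> 1"
  shows "norm ((\<Sum>n<N. u n) - (\<Sum>n<N. u (n + h))) \<le> 2 * real h"
proof (induction h)
  case (Suc h)
  have "(\<Sum>n<N. u (n + h)) - (\<Sum>n<N. u (n + Suc h)) = u h - u (N + h)"
    by (induction N) (simp_all add: algebra_simps)
  moreover have "norm (u h - u (N + h)) \<le> 2"
    using norm_triangle_ineq4[of "u h" "u (N + h)"] assms[of h] assms[of "N + h"] by linarith
  moreover have "norm ((\<Sum>n<N. u n) - (\<Sum>n<N. u (n + Suc h))) \<le>
      norm ((\<Sum>n<N. u n) - (\<Sum>n<N. u (n + h))) + norm ((\<Sum>n<N. u (n + h)) - (\<Sum>n<N. u (n + Suc h)))"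
    by (rule norm_diff_triangle_le[OF order_refl order_refl])
  ultimately show ?case
    using Suc.IH by simp
qed simp

text \<open>
  Replacing \<open>u n\<close> by the mean of \<open>u (n + h)\<close> over \<open>h < H\<close> changes the average over \<open>n < N\<close> by
  \<open>O(H / N)\<close> only. By Cauchy--Schwarz the square of the new average is at most \<open>1 / H\<^sup>2\<close> times the
  sum of the \<open>H\<^sup>2\<close> correlations; the \<open>H\<close> diagonal ones are bounded by \<open>1\<close> and the others tend to
  \<open>0\<close>, which leaves about \<open>1 / H\<close>, with \<open>H\<close> arbitrary. Correlations of two arbitrary shifts
  appear in the hypothesis, so that no double sum has to be re-indexed by the difference of the
  shifts.
\<close>

lemma van_der_Corput:
  fixes u :: "nat \<Rightarrow> complex"
  assumes bound: "\<And>n. norm (u n) \<le> 1"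
    and corr: "\<And>h h'. h \<noteq> h' \<Longrightarrow>
      (\<lambda>N. (\<Sum>n<N. u (n + h) * cnj (u (n + h'))) / of_nat N) \<longlonglongrightarrow> 0"
  shows "(\<lambda>N. (\<Sum>n<N. u n) / of_nat N) \<longlonglongrightarrow> 0"
proof (rule tendstoI)
  fix e :: real assume "e > 0"
  \<comment> \<open>The bound on the sum of all \<open>H\<^sup>2\<close> correlations will be \<open>H + 1\<close>: \<open>H\<close> for the diagonal and \<open>1\<close> for
    the rest, once \<open>N\<close> is large.\<close>
  have "(\<lambda>H. sqrt (real H + 1) / real H) \<longlonglongrightarrow> 0"
    by real_asymp
  then have "\<forall>\<^sub>F H in sequentially. sqrt (real H + 1) / real H < e / 2"
    using \<open>e > 0\<close> by (intro order_tendstoD(2)) auto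
  then have "\<forall>\<^sub>F H in sequentially. H > 0 \<and> sqrt (real H + 1) / real H < e / 2"
    by (intro eventually_conj eventually_gt_at_top)
  then obtain H where "H > 0" and H: "sqrt (real H + 1) / real H < e / 2"
    using eventually_happens'[OF sequentially_bot] by blast
  define w where "w n = (\<Sum>h<H. u (n + h))" for n
  define c where "c h h' N = (\<Sum>n<N. u (n + h) * cnj (u (n + h'))) / of_nat N" for h h' N
  have energy: "of_real (\<Sum>n<N. (norm (w n))\<^sup>2) / of_nat N = (\<Sum>h<H. \<Sum>h'<H. c h h' N)" for N
  proof -
    have "of_real (\<Sum>n<N. (norm (w n))\<^sup>2) = (\<Sum>n<N. \<Sum>h<H. \<Sum>h'<H. u (n + h) * cnj (u (n + h')))"
      by (simp add: w_def sum_product complex_norm_square del: of_real_power)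
    also have "\<dots> = (\<Sum>h<H. \<Sum>n<N. \<Sum>h'<H. u (n + h) * cnj (u (n + h')))"
      by (rule sum.swap)
    also have "\<dots> = (\<Sum>h<H. \<Sum>h'<H. \<Sum>n<N. u (n + h) * cnj (u (n + h')))"
      by (intro sum.cong refl sum.swap)
    finally show ?thesis
      by (simp add: c_def sum_divide_distrib)
  qed
  have diag: "norm (c h h N) \<le> 1" for h N
  proof -
    have "norm (\<Sum>n<N. u (n + h) * cnj (u (n + h))) \<le> real (card {..<N}) * 1"
      by (intro sum_norm_bound) (simp add: norm_mult mult_le_one bound)
    then show ?thesis
      by (cases "N = 0") (auto simp: c_def norm_divide divide_simps)
  qed
  have "(\<lambda>N. \<Sum>h<H. \<Sum>h'<H. norm (if h = h' then 0 else c h h' N)) \<longlonglongrightarrow> (\<Sum>h<H. \<Sum>h'<H. norm (0::complex))"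
  proof (intro tendsto_intros)
    show "(\<lambda>N. if h = h' then 0 else c h h' N) \<longlonglongrightarrow> 0" for h h'
      using corr[of h h'] by (cases "h = h'") (auto simp: c_def)
  qed
  then have "\<forall>\<^sub>F N in sequentially. (\<Sum>h<H. \<Sum>h'<H. norm (if h = h' then 0 else c h h' N)) < 1"
    by (intro order_tendstoD(2)) auto
  moreover have "(\<lambda>N. 2 * real H / real N) \<longlonglongrightarrow> 0"
    by real_asymp
  then have "\<forall>\<^sub>F N in sequentially. 2 * real H / real N < e / 2"
    using \<open>e > 0\<close> by (intro order_tendstoD(2)) auto
  ultimately show "\<forall>\<^sub>F N in sequentially. dist ((\<Sum>n<N. u n) / of_nat N) 0 < e"
    using eventually_gt_at_top[of 0]
  proof eventually_elim
    case (elim N)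
    have "(\<Sum>n<N. (norm (w n))\<^sup>2) / real N = norm (\<Sum>h<H. \<Sum>h'<H. c h h' N)"
      unfolding energy[symmetric] by (simp add: norm_divide sum_nonneg del: of_real_sum)
    also have "\<dots> \<le> (\<Sum>h<H. \<Sum>h'<H. norm (c h h' N))"
      by (intro sum_norm_le) auto
    also have "\<dots> \<le> (\<Sum>h<H. \<Sum>h'<H. (if h = h' then 1 else 0) + norm (if h = h' then 0 else c h h' N))"
      using diag by (intro sum_mono) auto
    also have "\<dots> \<le> real H + 1"
      using elim(1) by (simp add: sum.distrib)
    finally have *: "(\<Sum>n<N. (norm (w n))\<^sup>2) \<le> (real H + 1) * real N"
      using elim by (simp add: divide_simps)
    have "(norm (\<Sum>n<N. w n))\<^sup>2 \<le> (\<Sum>n<N. norm (w n))\<^sup>2"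
      by (intro power_mono norm_sum) auto
    also have "\<dots> \<le> (\<Sum>n<N. (norm (w n))\<^sup>2) * card {..<N}"
      by (rule sum_squared_le_sum_of_squares)
    also have "\<dots> \<le> (real H + 1) * (real N)\<^sup>2"
      using mult_right_mono[OF *, of "real N"] by (simp add: power2_eq_square mult.assoc)
    finally have "norm (\<Sum>n<N. w n) \<le> sqrt ((real H + 1) * (real N)\<^sup>2)"
      by (rule real_le_rsqrt)
    then have W: "norm (\<Sum>n<N. w n) \<le> sqrt (real H + 1) * real N"
      by (simp add: real_sqrt_mult)
    have "of_nat H * (\<Sum>n<N. u n) - (\<Sum>n<N. w n) = (\<Sum>h<H. (\<Sum>n<N. u n) - (\<Sum>n<N. u (n + h)))"
      unfolding w_def by (subst sum.swap) (simp add: sum_subtractf)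
    also have "norm \<dots> \<le> real (card {..<H}) * (2 * real H)"
    proof (rule sum_norm_bound)
      fix h assume "h \<in> {..<H}"
      then show "norm ((\<Sum>n<N. u n) - (\<Sum>n<N. u (n + h))) \<le> 2 * real H"
        using norm_diff_shifted_sum_le[of u N h, OF bound] by simp
    qed
    finally have "norm (of_nat H * (\<Sum>n<N. u n)) \<le> sqrt (real H + 1) * real N + real H * (2 * real H)"
      using W norm_triangle_sub[of "of_nat H * (\<Sum>n<N. u n)" "\<Sum>n<N. w n"] by simp
    then have "norm (\<Sum>n<N. u n) / real N \<le> sqrt (real H + 1) / real H + 2 * real H / real N"
      using \<open>H > 0\<close> elim by (simp add: norm_mult field_simps)
    also have "\<dots> < e"
      using H elim(2) by linarith
    finally show ?case
      by (simp add: norm_divide)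
  qed
qed

text \<open>
  Two shifts of \<open>p\<close> share the leading coefficient, so their difference has smaller degree. It is not
  constant either: otherwise \<open>p\<close> would grow linearly along the multiples of \<open>h - h'\<close>, hence agree
  with a polynomial of degree at most \<open>1\<close> at infinitely many points.
\<close>

lemma degree_shift_difference:
  fixes p :: "int poly" and h h' :: int
  assumes "h \<noteq> h'" and "degree p \<ge> 2"
  defines "q \<equiv> pcompose p [:h, 1:] - pcompose p [:h', 1:]"
  shows "0 < degree q" and "degree q < degree p"
proof -
  have deg: "degree (pcompose p [:a, 1:]) = degree p" for a :: int
    by (simp add: degree_pcompose)
  show "degree q < degree p"
  proof -
    have "coeff (pcompose p [:a, 1:]) (degree p) = lead_coeff p" for a :: int
      using lead_coeff_comp[of "[:a, 1:]" p] deg[of a] by simp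
    then have "coeff q (degree p) = 0"
      by (simp add: q_def)
    moreover have "degree q \<le> degree p"
      unfolding q_def by (intro degree_diff_le) (simp_all add: deg)
    ultimately show ?thesis
      using \<open>degree p \<ge> 2\<close> leading_coeff_0_iff[of q] by (cases "degree q = degree p") auto
  qed
  show "0 < degree q"
  proof (rule ccontr)
    assume "\<not> 0 < degree q"
    then obtain c where c: "q = [:c:]"
      using degree_eq_zeroE by blast
    define d where "d = h - h'"
    have step: "poly p (x + d) = poly p x + c" for x
    proof -
      have "poly q (x - h') = c"
        by (simp add: c)
      then show ?thesis
        by (simp add: q_def poly_pcompose d_def algebra_simps)
    qed
    have at_multiples: "poly p (d * int m) = poly p 0 + c * int m" for m
    proof (induction m)
      case (Suc m)
      then show ?case
        using step[of "d * int m"] by (simp add: algebra_simps)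
    qed simp
    define r where "r = pcompose p [:0, d:] - [:poly p 0, c:]"
    have "range int \<subseteq> {x. poly r x = 0}"
      by (auto simp: r_def poly_pcompose at_multiples algebra_simps)
    then have "infinite {x. poly r x = 0}"
      using infinite_super range_inj_infinite inj_of_nat by blast
    then have "pcompose p [:0, d:] = [:poly p 0, c:]"
      using poly_roots_finite[of r] by (auto simp: r_def)
    then have "degree p * degree [:0, d:] \<le> 1"
      using degree_pcompose[of p "[:0, d:]"] by (auto split: if_splits)
    then show False
      using assms by (simp add: d_def)
  qed
qed

text \<open>
  Induction on the degree. A linear phase gives a geometric sum whose ratio is not \<open>1\<close> because
  \<open>lam\<close> is not a root of unity. For higher degree, the correlations in van der Corput's lemma are
  sums of the same kind with a phase of smaller, still positive, degree.
\<close>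

lemma Weyl_polynomial_sum:
  fixes p :: "int poly"
  assumes lam: "lam \<in> circle" "irrational lam" and "degree p > 0"
  shows "(\<lambda>N. (\<Sum>n<N. lam powi (poly p (int n))) / of_nat N) \<longlonglongrightarrow> 0"
  using \<open>degree p > 0\<close>
proof (induction "degree p" arbitrary: p rule: less_induct)
  case less
  have norm: "norm (lam powi m) = 1" for m
    using lam by (simp add: norm_power_int)
  have "lam \<noteq> 0"
    using lam by auto
  show ?case
  proof (cases "degree p = 1")
    case True
    obtain b p' where "p = pCons b p'"
      by (rule pCons_cases)
    with True obtain a where p: "p = [:b, a:]" and "a \<noteq> 0"
      by (auto split: if_splits elim!: degree_eq_zeroE)
    define r where "r = lam powi a"
    have "r \<noteq> 1"
    proof
      assume "r = 1"
      then have "lam ^ nat \<bar>a\<bar> = 1"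
        by (cases "a > 0") (auto simp: r_def power_int_def field_simps power_inverse split: if_splits)
      then show False
        using lam(2) \<open>a \<noteq> 0\<close> by (simp add: irrational_def)
    qed
    have "(\<Sum>n<N. lam powi (poly p (int n))) = lam powi b * ((r ^ N - 1) / (r - 1))" for N
    proof -
      have "lam powi (poly p (int n)) = lam powi b * r ^ n" for n
        using \<open>lam \<noteq> 0\<close> by (simp add: p r_def power_int_add power_int_mult mult.commute)
      then show ?thesis
        using \<open>r \<noteq> 1\<close> by (simp add: sum_distrib_left[symmetric] geometric_sum)
    qed
    moreover have "norm (lam powi b * ((r ^ N - 1) / (r - 1))) \<le> 2 / norm (r - 1)" for N
      using norm_triangle_ineq4[of "r ^ N" 1] norm[of a] 
      by (simp add: norm_mult norm norm_divide norm_power r_def[symmetric] divide_right_mono)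
    ultimately have "norm ((\<Sum>n<N. lam powi (poly p (int n))) / of_nat N) \<le> (2 / norm (r - 1)) / real N" for N
      by (simp only: norm_divide norm_of_nat divide_right_mono of_nat_0_le_iff)
    then show ?thesis
      by (rule Lim_null_comparison[OF always_eventually[OF allI] lim_const_over_n])
  next
    case False
    with less.prems have "degree p \<ge> 2"
      by simp
    show ?thesis
    proof (rule van_der_Corput)
      fix h h' :: nat assume "h \<noteq> h'"
      define q where "q = pcompose p [:int h, 1:] - pcompose p [:int h', 1:]"
      have "lam powi poly p (int (n + h)) * cnj (lam powi poly p (int (n + h'))) = lam powi poly q (int n)" for n
      proof -
        have "cnj (lam powi poly p (int (n + h'))) = inverse (lam powi poly p (int (n + h')))"
          by (rule inverse_unique[symmetric]) (simp add: complex_norm_square[symmetric] norm del: complex_cnj_power_int)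
        then show ?thesis
          using \<open>lam \<noteq> 0\<close> by (simp add: q_def poly_pcompose power_int_diff divide_inverse add.commute)
      qed
      moreover have "(\<lambda>N. (\<Sum>n<N. lam powi poly q (int n)) / of_nat N) \<longlonglongrightarrow> 0"
        using degree_shift_difference[of "int h" "int h'" p] \<open>h \<noteq> h'\<close> \<open>degree p \<ge> 2\<close> less.hyps[of q]
        by (simp add: q_def)
      ultimately show "(\<lambda>N. (\<Sum>n<N. lam powi poly p (int (n + h)) * cnj (lam powi poly p (int (n + h')))) / of_nat N) \<longlonglongrightarrow> 0"
        by simp
    qed (simp add: norm)
  qed
qed

section \<open>Density from vanishing character means\<close>

text \<open>
  On the unit circle \<open>\<bar>1 + s\<bar>\<^sup>2 = (1 + s)\<^sup>2 / s\<close>, which makes this power a trigonometric polynomial: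
  a nonnegative kernel that peaks at \<open>s = 1\<close> and has constant coefficient \<open>2N choose N\<close>.
\<close>

lemma norm_one_plus_power_expansion:
  fixes s :: complex
  assumes "norm s = 1"
  shows "of_real (norm (1 + s) ^ (2 * N)) = (\<Sum>m\<le>2 * N. of_nat ((2 * N) choose m) * s powi (int m - int N))"
proof -
  have "s \<noteq> 0"
    using assms by auto
  have "s * cnj s = 1"
    using assms by (simp add: complex_norm_square[symmetric])
  then have "cnj s = inverse s"
    using inverse_unique by metis
  then have "of_real ((norm (1 + s))\<^sup>2) = (s + 1) * (1 + inverse s)"
    unfolding complex_norm_square by (simp add: add.commute)
  also have "\<dots> = (s + 1)\<^sup>2 * inverse s"
    using \<open>s \<noteq> 0\<close> by (simp add: power2_eq_square algebra_simps)
  finally have "of_real (norm (1 + s) ^ (2 * N)) = ((s + 1)\<^sup>2 * inverse s) ^ N"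
    by (simp add: power_mult)
  also have "\<dots> = (s + 1) ^ (2 * N) * inverse (s ^ N)"
    by (simp add: power_mult power_mult_distrib power_inverse)
  also have "\<dots> = (\<Sum>m\<le>2 * N. of_nat ((2 * N) choose m) * s powi (int m - int N))"
    using \<open>s \<noteq> 0\<close> by (simp add: binomial_ring sum_distrib_right power_int_diff divide_inverse mult.assoc)
  finally show ?thesis .
qed

text \<open>
  Weyl's criterion in its topological form. Average the kernel
  \<open>\<Prod>j\<in>J. \<bar>1 + z n j / y j\<bar> ^ (2 * N)\<close> over \<open>n\<close>. Only the constant term of its expansion into
  characters survives, so the average tends to \<open>(2N choose N) ^ card J\<close>, which is
  \<open>4 ^ (N * card J)\<close> up to a factor polynomial in \<open>N\<close>. If the sequence kept away from \<open>y\<close>, every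
  value of the kernel would be at most \<open>4 ^ (N * card J) * q ^ N\<close> with a fixed \<open>q < 1\<close>, which is
  exponentially smaller and hence impossible for large \<open>N\<close>.
\<close>

lemma dense_if_character_means_vanish:
  fixes z :: "nat \<Rightarrow> 'i \<Rightarrow> complex" and J :: "'i set"
  assumes "finite J"
    and z: "\<And>n j. j \<in> J \<Longrightarrow> z n j \<in> circle"
    and means: "\<And>c :: 'i \<Rightarrow> int. \<exists>j\<in>J. c j \<noteq> 0 \<Longrightarrow>
      (\<lambda>M. (\<Sum>n<M. \<Prod>j\<in>J. z n j powi c j) / of_nat M) \<longlonglongrightarrow> 0"
    and y: "\<And>j. j \<in> J \<Longrightarrow> y j \<in> circle"
    and "\<delta> > 0"
  shows "\<exists>n. \<forall>j\<in>J. dist (z n j) (y j) < \<delta>"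
proof (rule ccontr)
  assume "\<not> ?thesis"
  then have far: "\<exists>j\<in>J. norm (z n j - y j) \<ge> \<delta>" for n
    by (auto simp: dist_norm not_less)
  define s where "s n j = z n j / y j" for n j
  have s: "norm (s n j) = 1" if "j \<in> J" for n j
    using z[OF that] y[OF that] by (simp add: s_def norm_divide)
  \<comment> \<open>The parallelogram law turns \<open>\<bar>1 - s\<bar> \<ge> \<delta>\<close> into \<open>\<bar>1 + s\<bar>\<^sup>2 \<le> 4 - \<delta>\<^sup>2 = 4 * q\<close>.\<close>
  define q where "q = 1 - \<delta>\<^sup>2 / 4"
  have "q < 1"
    using \<open>\<delta> > 0\<close> by (simp add: q_def)
  have factor_le: "(norm (1 + s n j))\<^sup>2 \<le> 4" if "j \<in> J" for n j
  proof -
    have "norm (1 + s n j) \<le> 2"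
      using norm_triangle_ineq[of 1 "s n j"] s[OF that] by simp
    then show ?thesis
      using power_mono[of "norm (1 + s n j)" 2 2] by simp
  qed
  have small: "\<exists>j\<in>J. (norm (1 + s n j))\<^sup>2 \<le> 4 * q" for n
  proof -
    obtain j where j: "j \<in> J" "norm (z n j - y j) \<ge> \<delta>"
      using far by blast
    have "norm (y j) = 1"
      using y[OF j(1)] by simp
    have "1 - s n j = (y j - z n j) / y j"
      using \<open>norm (y j) = 1\<close> by (auto simp: s_def diff_divide_distrib)
    then have "norm (1 - s n j) = norm (z n j - y j)"
      using \<open>norm (y j) = 1\<close> by (simp add: norm_divide norm_minus_commute)
    then have "\<delta>\<^sup>2 \<le> (norm (1 - s n j))\<^sup>2"
      using j \<open>\<delta> > 0\<close> by (intro power_mono) auto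
    moreover have "(norm (1 + s n j))\<^sup>2 + (norm (1 - s n j))\<^sup>2 = 2 * (norm (1::complex))\<^sup>2 + 2 * (norm (s n j))\<^sup>2"
      unfolding cmod_power2 by (simp add: power2_eq_square algebra_simps)
    ultimately show ?thesis
      using j(1) s[OF j(1)] by (intro bexI[of _ j]) (auto simp: q_def)
  qed
  have "0 \<le> q"
  proof -
    obtain j where "(norm (1 + s 0 j))\<^sup>2 \<le> 4 * q"
      using small by blast
    then show ?thesis
      using zero_le_power2[of "norm (1 + s 0 j)"] by linarith
  qed
  have product_le: "(\<Prod>j\<in>J. (norm (1 + s n j))\<^sup>2) \<le> 4 ^ card J * q" for n
  proof -
    obtain i where i: "i \<in> J" "(norm (1 + s n i))\<^sup>2 \<le> 4 * q"
      using small by blast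
    have "(\<Prod>j\<in>J. (norm (1 + s n j))\<^sup>2) = (norm (1 + s n i))\<^sup>2 * (\<Prod>j\<in>J - {i}. (norm (1 + s n j))\<^sup>2)"
      using \<open>finite J\<close> i(1) by (rule prod.remove)
    also have "\<dots> \<le> (4 * q) * (\<Prod>j\<in>J - {i}. 4)"
      using i factor_le \<open>0 \<le> q\<close> by (intro mult_mono prod_mono prod_nonneg) auto
    also have "\<dots> = 4 ^ Suc (card (J - {i})) * q"
      by simp
    also have "Suc (card (J - {i})) = card J"
      using \<open>finite J\<close> i(1) by (metis card.remove)
    finally show ?thesis .
  qed
  define kernel where "kernel N n = (\<Prod>j\<in>J. norm (1 + s n j) ^ (2 * N))" for N n
  define weight where "weight N g = (\<Prod>j\<in>J. of_nat ((2 * N) choose g j) * inverse (y j powi (int (g j) - int N)))"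
    for N and g :: "'i \<Rightarrow> nat"
  define avg where "avg c M = (\<Sum>n<M. \<Prod>j\<in>J. z n j powi c j) / of_nat M" for c :: "'i \<Rightarrow> int" and M
  define I where "I N = PiE J (\<lambda>_. {..2 * N})" for N :: nat
  \<comment> \<open>The index of the constant term, where every exponent \<open>g j - N\<close> vanishes.\<close>
  define centre where "centre N = (\<lambda>j\<in>J. N)" for N :: nat
  have expansion: "complex_of_real ((\<Sum>n<M. kernel N n) / real M) =
      (\<Sum>g\<in>I N. weight N g * avg (\<lambda>j. int (g j) - int N) M)" for N M
  proof -
    have "of_real (kernel N n) = (\<Sum>g\<in>I N. weight N g * (\<Prod>j\<in>J. z n j powi (int (g j) - int N)))" for n
    proof -
      have "of_real (kernel N n) = (\<Prod>j\<in>J. complex_of_real (norm (1 + s n j) ^ (2 * N)))"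
        by (simp add: kernel_def)
      also have "\<dots> = (\<Prod>j\<in>J. \<Sum>m\<le>2 * N. of_nat ((2 * N) choose m) * s n j powi (int m - int N))"
        using s norm_one_plus_power_expansion by (intro prod.cong) auto
      also have "\<dots> = (\<Sum>g\<in>I N. \<Prod>j\<in>J. of_nat ((2 * N) choose g j) * s n j powi (int (g j) - int N))"
        unfolding I_def using \<open>finite J\<close> by (intro prod_sum_PiE) auto
      finally show ?thesis
        by (simp add: weight_def s_def divide_inverse power_int_mult_distrib power_int_inverse prod.distrib[symmetric] ac_simps)
    qed
    then have "complex_of_real (\<Sum>n<M. kernel N n) =
        (\<Sum>g\<in>I N. weight N g * (\<Sum>n<M. \<Prod>j\<in>J. z n j powi (int (g j) - int N)))"
      by (simp add: sum.swap[of _ "I N"] sum_distrib_left)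
    then show ?thesis
      by (simp only: avg_def of_real_divide of_real_of_nat_eq sum_divide_distrib[of _ "I N"] times_divide_eq_right)
  qed
  have mean: "(\<lambda>M. (\<Sum>n<M. kernel N n) / real M) \<longlonglongrightarrow> real ((2 * N) choose N) ^ card J" for N
  proof -
    have "(\<lambda>M. weight N g * avg (\<lambda>j. int (g j) - int N) M) \<longlonglongrightarrow> (if g = centre N then of_nat ((2 * N) choose N) ^ card J else 0)"
      if "g \<in> I N" for g
    proof (cases "g = centre N")
      case True
      then have "weight N g * avg (\<lambda>j. int (g j) - int N) M = of_nat ((2 * N) choose N) ^ card J" if "M > 0" for M
        using that by (simp add: weight_def avg_def centre_def)
      then have "\<forall>\<^sub>F M in sequentially. weight N g * avg (\<lambda>j. int (g j) - int N) M = of_nat ((2 * N) choose N) ^ card J"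
        by (intro eventually_sequentiallyI[of 1]) simp
      then show ?thesis
        using True by (simp add: tendsto_eventually)
    next
      case False
      then have "\<exists>j\<in>J. int (g j) - int N \<noteq> 0"
        using that by (auto simp: I_def centre_def PiE_def extensional_def fun_eq_iff split: if_splits)
      then have "avg (\<lambda>j. int (g j) - int N) \<longlonglongrightarrow> 0"
        unfolding avg_def[abs_def] by (rule means)
      then show ?thesis
        using False by (simp add: tendsto_mult_right_zero)
    qed
    then have "(\<lambda>M. \<Sum>g\<in>I N. weight N g * avg (\<lambda>j. int (g j) - int N) M) \<longlonglongrightarrow>
        (\<Sum>g\<in>I N. if g = centre N then of_nat ((2 * N) choose N) ^ card J else 0)"
      by (intro tendsto_sum)
    also have "(\<Sum>g\<in>I N. if g = centre N then of_nat ((2 * N) choose N) ^ card J else 0) = complex_of_real (real ((2 * N) choose N) ^ card J)"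
      using \<open>finite J\<close> by (subst sum.delta) (auto simp: I_def centre_def finite_PiE)
    finally show ?thesis
      unfolding expansion[symmetric] by (simp only: tendsto_of_real_iff)
  qed
  have polynomial_beats_exponential: "1 \<le> (2 * real N) ^ card J * q ^ N" if "N > 0" for N
  proof -
    have "kernel N n \<le> (4 ^ card J * q) ^ N" for n
    proof -
      have "kernel N n = (\<Prod>j\<in>J. (norm (1 + s n j))\<^sup>2) ^ N"
        by (simp add: kernel_def power_mult prod_power_distrib)
      also have "\<dots> \<le> (4 ^ card J * q) ^ N"
        by (intro power_mono product_le prod_nonneg) auto
      finally show ?thesis .
    qed
    then have "(\<Sum>n<M. kernel N n) \<le> real (card {..<M}) * (4 ^ card J * q) ^ N" for M
      by (intro sum_bounded_above)
    then have "(\<Sum>n<M. kernel N n) / real M \<le> (4 ^ card J * q) ^ N" if "M > 0" for M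
      using that by (simp add: divide_simps mult.commute)
    then have "real ((2 * N) choose N) ^ card J \<le> (4 ^ card J * q) ^ N"
      by (intro tendsto_upperbound[OF mean] eventually_sequentiallyI[of 1]) auto
    moreover have "(4 ^ N / (2 * real N)) ^ card J \<le> real ((2 * N) choose N) ^ card J"
      using central_binomial_lower_bound[OF that] by (intro power_mono) auto
    ultimately have "(4 ^ N / (2 * real N)) ^ card J \<le> (4 ^ card J * q) ^ N"
      by linarith
    then have "(4 ^ N) ^ card J \<le> (4 ^ N) ^ card J * ((2 * real N) ^ card J * q ^ N)"
      using that by (simp add: power_divide power_mult_distrib divide_le_eq power_mult[symmetric] mult.commute mult.left_commute)
    then show ?thesis
      by simp
  qed
  have "card J > 0"
    using far[of 0] \<open>finite J\<close> by (auto simp: card_gt_0_iff)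
  \<comment> \<open>With \<open>q = r ^ card J\<close> this bound is the power \<open>card J\<close> of \<open>2 * N * r ^ N\<close>.\<close>
  define r where "r = root (card J) q"
  have r: "r ^ card J = q" "0 \<le> r" "r < 1"
    using \<open>0 \<le> q\<close> \<open>q < 1\<close> \<open>card J > 0\<close> by (simp_all add: r_def)
  have "(\<lambda>N. (2 * (real N * r ^ N)) ^ card J) \<longlonglongrightarrow> (2 * 0) ^ card J"
    using r powser_times_n_limit_0[of r] by (intro tendsto_intros) simp
  also have "(2 * 0) ^ card J = (0 :: real)"
    using \<open>card J > 0\<close> by simp
  finally have "\<forall>\<^sub>F N in sequentially. (2 * (real N * r ^ N)) ^ card J < 1"
    by (rule order_tendstoD) simp
  then have "\<forall>\<^sub>F N in sequentially. N > 0 \<and> (2 * (real N * r ^ N)) ^ card J < 1"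
    by (intro eventually_conj eventually_gt_at_top)
  then obtain N where N: "N > 0" "(2 * (real N * r ^ N)) ^ card J < 1"
    using eventually_happens'[OF sequentially_bot] by blast
  have "(2 * (real N * r ^ N)) ^ card J = (2 * real N) ^ card J * (r ^ card J) ^ N"
    by (simp add: power_mult_distrib power_mult[symmetric] mult.commute)
  then show False
    using polynomial_beats_exponential[OF N(1)] N(2) r(1) by simp
qed

section \<open>A dense orbit in the torus\<close>

lemma power_int_sum_exponent:
  fixes z :: "'a :: field"
  assumes "z \<noteq> 0"
  shows "z powi (\<Sum>i\<in>A. f i) = (\<Prod>i\<in>A. z powi f i)"
  using assms by (induction A rule: infinite_finite_induct) (auto simp: power_int_add)

lemma power_int_prod_base:
  fixes f :: "'i \<Rightarrow> 'a :: field"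
  shows "(\<Prod>i\<in>A. f i) powi m = (\<Prod>i\<in>A. f i powi m)"
  by (induction A rule: infinite_finite_induct) (auto simp: power_int_mult_distrib)

lemma circle_not_zero: "z \<in> circle \<Longrightarrow> z \<noteq> 0"
  by auto

lemma power_int_in_circle: "z \<in> circle \<Longrightarrow> z powi m \<in> circle"
  by (simp add: norm_power_int)

lemma torus_coordinate: "x \<in> topspace (torus k) \<Longrightarrow> i \<in> {1..k} \<Longrightarrow> x i \<in> circle"
  by (auto simp: torus_def PiE_def Pi_def)

lemma compact_space_torus: "compact_space (torus k)"
  by (simp add: torus_def compact_space_product_topology compact_space_subtopology)

lemma Hausdorff_space_torus: "Hausdorff_space (torus k)"
  by (simp add: torus_def Hausdorff_space_product_topology Hausdorff_space_subtopology)

text \<open>The torus has finitely many coordinates, so a basic neighbourhood contains one of uniform radius.\<close>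

lemma torus_closure_of_eq_topspace:
  assumes "S \<subseteq> topspace (torus k)"
    and approx: "\<And>y \<delta>. y \<in> topspace (torus k) \<Longrightarrow> \<delta> > 0 \<Longrightarrow> \<exists>x\<in>S. \<forall>i\<in>{1..k}. dist (x i) (y i) < \<delta>"
  shows "torus k closure_of S = topspace (torus k)"
proof (intro subset_antisym closure_of_subset_topspace subsetI)
  fix y assume y: "y \<in> topspace (torus k)"
  show "y \<in> torus k closure_of S"
    unfolding in_closure_of
  proof (intro conjI y allI impI)
    fix U assume "y \<in> U \<and> openin (torus k) U"
    then have "y \<in> U"
      and "\<forall>x\<in>U. \<exists>B. finite {i \<in> {1..k}. B i \<noteq> topspace (top_of_set circle)} \<and>
        (\<forall>i\<in>{1..k}. openin (top_of_set circle) (B i)) \<and> x \<in> Pi\<^sub>E {1..k} B \<and> Pi\<^sub>E {1..k} B \<subseteq> U"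
      unfolding torus_def openin_product_topology_alt by simp_all
    from bspec[OF this(2,1)] obtain B where B: "\<forall>i\<in>{1..k}. openin (top_of_set circle) (B i)"
      and yB: "y \<in> Pi\<^sub>E {1..k} B" and sub: "Pi\<^sub>E {1..k} B \<subseteq> U"
      by (elim exE conjE) (rule that)
    have "\<exists>e>0. ball (y i) e \<inter> circle \<subseteq> B i" if "i \<in> {1..k}" for i
      using bspec[OF B that] PiE_mem[OF yB that] unfolding openin_contains_ball by blast
    then obtain e where e: "\<And>i. i \<in> {1..k} \<Longrightarrow> e i > 0 \<and> ball (y i) (e i) \<inter> circle \<subseteq> B i"
      by metis
    define \<delta> where "\<delta> = Min (insert 1 (e ` {1..k}))"
    have "\<delta> > 0"
      using e by (simp add: \<delta>_def)
    then obtain x where x: "x \<in> S" "\<forall>i\<in>{1..k}. dist (x i) (y i) < \<delta>"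
      using approx[OF y] by blast
    have "x i \<in> B i" if "i \<in> {1..k}" for i
    proof -
      have "\<delta> \<le> e i"
        unfolding \<delta>_def using that by (intro Min_le) auto
      then have "x i \<in> ball (y i) (e i) \<inter> circle"
        using bspec[OF x(2) that] torus_coordinate[OF subsetD[OF assms(1) x(1)] that]
        by (auto simp: dist_commute)
      then show ?thesis
        using e[OF that] by blast
    qed
    then have "x \<in> Pi\<^sub>E {1..k} B"
      using x(1) assms(1) by (auto simp: torus_def PiE_def)
    then show "\<exists>x. x \<in> S \<and> x \<in> U"
      using x(1) sub by blast
  qed
qed

text \<open>
  The point \<open>T\<^sup>n (1, \<dots>, 1)\<close> in closed form, where \<open>T = milnes_map k lam\<close>.
\<close>

definition orbit_point :: "nat \<Rightarrow> complex \<Rightarrow> int \<Rightarrow> nat \<Rightarrow> complex" where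
  "orbit_point k lam n = (\<lambda>j\<in>{1..k}. lam powi (int (k choose j) * n ^ j))"

lemma orbit_point_in_torus: "lam \<in> circle \<Longrightarrow> orbit_point k lam n \<in> topspace (torus k)"
  using power_int_in_circle by (auto simp: orbit_point_def torus_def)

text \<open>
  The exponents \<open>(k choose j) * n ^ j\<close> have pairwise different degrees and nonzero coefficients.
  Hence a nontrivial character of the torus, evaluated along the orbit, is \<open>lam powi p n\<close> for a
  nonconstant integer polynomial \<open>p\<close>, and Weyl's theorem applies to it.
\<close>

lemma torus_orbit_points_dense:
  assumes lam: "lam \<in> circle" "irrational lam"
  shows "torus k closure_of range (orbit_point k lam) = topspace (torus k)"
proof (rule torus_closure_of_eq_topspace)
  show "range (orbit_point k lam) \<subseteq> topspace (torus k)"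
    using orbit_point_in_torus[OF lam(1)] by blast
next
  fix y :: "nat \<Rightarrow> complex" and \<delta> :: real
  assume y: "y \<in> topspace (torus k)" and "\<delta> > 0"
  have "\<exists>n. \<forall>j\<in>{1..k}. dist (orbit_point k lam (int n) j) (y j) < \<delta>"
  proof (rule dense_if_character_means_vanish)
    fix c :: "nat \<Rightarrow> int" assume "\<exists>j\<in>{1..k}. c j \<noteq> 0"
    then obtain i where i: "i \<in> {1..k}" "c i \<noteq> 0" by blast
    define p where "p = (\<Sum>j=1..k. monom (int (k choose j) * c j) j)"
    have "coeff p i = int (k choose i) * c i"
      using i by (simp add: p_def coeff_sum)
    then have "coeff p i \<noteq> 0"
      using i by simp
    then have "degree p > 0"
      using i le_degree[of p i] by simp
    have "orbit_point k lam (int n) j powi c j = lam powi (int (k choose j) * c j * int n ^ j)"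
      if "j \<in> {1..k}" for n j
      using that by (simp add: orbit_point_def power_int_mult[symmetric] ac_simps)
    then have "(\<Prod>j=1..k. orbit_point k lam (int n) j powi c j) = lam powi (poly p (int n))" for n
      by (simp add: p_def poly_sum poly_monom power_int_sum_exponent[OF circle_not_zero[OF lam(1)]])
    with Weyl_polynomial_sum[OF lam \<open>degree p > 0\<close>]
    show "(\<lambda>M. (\<Sum>n<M. \<Prod>j=1..k. orbit_point k lam (int n) j powi c j) / of_nat M) \<longlonglongrightarrow> 0"
      by (simp only:)
  next
    fix n :: nat and j assume "j \<in> {1..k}"
    then show "orbit_point k lam (int n) j \<in> circle" "y j \<in> circle"
      by (rule torus_coordinate[OF orbit_point_in_torus[OF lam(1)]], rule torus_coordinate[OF y])
  qed (rule finite_atLeastAtMost, rule \<open>\<delta> > 0\<close>)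
  then show "\<exists>x\<in>range (orbit_point k lam). \<forall>i\<in>{1..k}. dist (x i) (y i) < \<delta>"
    by (metis rangeI)
qed

section \<open>The skew product on the torus\<close>

text \<open>
  The \<open>i\<close>-th coordinate of the image is \<open>x i\<close> times a unimodular factor that depends on the earlier
  coordinates only. Both injectivity and surjectivity follow by solving for one coordinate after
  the other.
\<close>

lemma milnes_map_eq_triangular:
  assumes "i \<in> {1..k}"
  shows "milnes_map k lam x i = x i * (lam ^ (k choose i) * (\<Prod>j=1..<i. x j ^ ((k - j) choose (i - j))))"
proof -
  have "{1..i} = insert i {1..<i}"
    using assms by auto
  then show ?thesis
    using assms by (simp add: milnes_map_def ac_simps)
qed

lemma milnes_map_in_torus:
  assumes "lam \<in> circle" "x \<in> topspace (torus k)"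
  shows "milnes_map k lam x \<in> topspace (torus k)"
proof -
  have "norm (x j) = 1" if "j \<in> {1..k}" for j
    using torus_coordinate[OF assms(2) that] by simp
  then show ?thesis
    using assms(1) by (auto simp: torus_def milnes_map_def norm_mult norm_power prod_norm[symmetric])
qed

lemma inj_on_milnes_map:
  assumes "lam \<in> circle"
  shows "inj_on (milnes_map k lam) (topspace (torus k))"
proof (rule inj_onI)
  fix x y assume x: "x \<in> topspace (torus k)" and y: "y \<in> topspace (torus k)"
    and eq: "milnes_map k lam x = milnes_map k lam y"
  have "x i = y i" if "i \<in> {1..k}" for i
    using that
  proof (induction i rule: less_induct)
    case (less i)
    have prods: "(\<Prod>j=1..<i. x j ^ ((k - j) choose (i - j))) = (\<Prod>j=1..<i. y j ^ ((k - j) choose (i - j)))"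
      using less by (intro prod.cong) auto
    have "y j \<noteq> 0" if "j \<in> {1..<i}" for j
      using circle_not_zero torus_coordinate[OF y, of j] that less.prems by auto
    then have "lam ^ (k choose i) * (\<Prod>j=1..<i. y j ^ ((k - j) choose (i - j))) \<noteq> 0"
      using circle_not_zero[OF assms] by simp
    moreover have "milnes_map k lam x i = milnes_map k lam y i"
      using eq by simp
    ultimately show ?case
      unfolding milnes_map_eq_triangular[OF less.prems] prods using mult_right_cancel by blast
  qed
  then show "x = y"
    using x y by (intro PiE_ext[of x "{1..k}" "\<lambda>_. circle" y]) (auto simp: torus_def)
qed

lemma milnes_map_image_torus:
  assumes "lam \<in> circle"
  shows "milnes_map k lam ` topspace (torus k) = topspace (torus k)"
proof (intro subset_antisym subsetI)
  fix y assume y: "y \<in> topspace (torus k)"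
  have "\<exists>x\<in>topspace (torus k). \<forall>i\<in>{1..m}. milnes_map k lam x i = y i" if "m \<le> k" for m
    using that
  proof (induction m)
    case 0
    then show ?case
      using y by auto
  next
    case (Suc m)
    then obtain x where x: "x \<in> topspace (torus k)" "\<forall>i\<in>{1..m}. milnes_map k lam x i = y i"
      by auto
    have m: "Suc m \<in> {1..k}"
      using Suc.prems by simp
    define d where "d = lam ^ (k choose Suc m) * (\<Prod>j=1..<Suc m. x j ^ ((k - j) choose (Suc m - j)))"
    define x' where "x' = x(Suc m := y (Suc m) / d)"
    have "norm (x j) = 1" if "j \<in> {1..k}" for j
      using torus_coordinate[OF x(1) that] by simp
    then have "norm d = 1"
      using assms Suc.prems by (simp add: d_def norm_mult norm_power prod_norm[symmetric])
    then have "x' \<in> topspace (torus k)"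
      using x(1) m torus_coordinate[OF y m] by (auto simp: x'_def torus_def norm_divide PiE_def Pi_def extensional_def)
    moreover have "milnes_map k lam x' i = y i" if "i \<in> {1..Suc m}" for i
    proof (cases "i = Suc m")
      case True
      have "(\<Prod>j=1..<Suc m. x' j ^ ((k - j) choose (Suc m - j))) = (\<Prod>j=1..<Suc m. x j ^ ((k - j) choose (Suc m - j)))"
        by (intro prod.cong) (auto simp: x'_def)
      then have "milnes_map k lam x' (Suc m) = x' (Suc m) * d"
        unfolding milnes_map_eq_triangular[OF m] d_def by simp
      then show ?thesis
        using True \<open>norm d = 1\<close> by (auto simp: x'_def)
    next
      case False
      then have i: "i \<in> {1..m}" "i \<in> {1..k}"
        using that Suc.prems by auto
      have "milnes_map k lam x' i = milnes_map k lam x i"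
        using i by (auto simp: milnes_map_def x'_def intro!: prod.cong)
      then show ?thesis
        using x(2) i by simp
    qed
    ultimately show ?case
      by blast
  qed
  from this[of k] obtain x where x: "x \<in> topspace (torus k)" "\<forall>i\<in>{1..k}. milnes_map k lam x i = y i"
    by auto
  then have "milnes_map k lam x = y"
    using y milnes_map_in_torus[OF assms x(1)]
    by (intro PiE_ext[of _ "{1..k}" "\<lambda>_. circle" y]) (auto simp: torus_def)
  then show "y \<in> milnes_map k lam ` topspace (torus k)"
    using x(1) by blast
qed (use milnes_map_in_torus[OF assms] in blast)

lemma continuous_map_torus_power_int:
  assumes "j \<in> {1..k}"
  shows "continuous_map (torus k) euclidean (\<lambda>x. x j powi m)"
proof -
  have "continuous_map (torus k) (top_of_set circle) (\<lambda>x. x j)"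
    unfolding torus_def using assms by (rule continuous_map_product_projection)
  moreover have "continuous_map (top_of_set circle) euclidean (\<lambda>z :: complex. z powi m)"
    by (auto intro!: continuous_intros)
  ultimately show ?thesis
    by (rule continuous_map_compose[unfolded o_def])
qed

lemma continuous_map_torus_monomial:
  fixes a :: complex
  assumes "J \<subseteq> {1..k}"
  shows "continuous_map (torus k) euclidean (\<lambda>x. a * (\<Prod>j\<in>J. x j powi e j))"
  using assms continuous_map_torus_power_int unfolding continuous_map_atin limitin_canonical_iff
  by (intro ballI tendsto_mult tendsto_const tendsto_prod) blast

lemma continuous_map_milnes_map:
  assumes "lam \<in> circle"
  shows "continuous_map (torus k) (torus k) (milnes_map k lam)"
proof -
  have "continuous_map (torus k) (top_of_set circle) (\<lambda>x. milnes_map k lam x i)" if "i \<in> {1..k}" for i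
  proof -
    have "continuous_map (torus k) euclidean
        (\<lambda>x. lam ^ (k choose i) * (\<Prod>j=1..i. x j powi int ((k - j) choose (i - j))))"
      using that by (intro continuous_map_torus_monomial) auto
    then have "continuous_map (torus k) euclidean (\<lambda>x. milnes_map k lam x i)"
      using that by (simp add: milnes_map_def)
    then show ?thesis
      using torus_coordinate[OF milnes_map_in_torus[OF assms] that]
      by (auto simp: continuous_map_in_subtopology)
  qed
  moreover have "milnes_map k lam ` topspace (torus k) \<subseteq> extensional {1..k}"
    by (auto simp: milnes_map_def)
  ultimately show ?thesis
    unfolding torus_def continuous_map_componentwise by blast
qed

lemma dynamical_system_torus:
  assumes "lam \<in> circle"
  shows "dynamical_system (torus k) (milnes_map k lam)"
  unfolding dynamical_system_def
  using compact_space_torus Hausdorff_space_torus continuous_map_milnes_map[OF assms]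
    milnes_map_image_torus[OF assms] inj_on_milnes_map[OF assms]
  by (intro conjI continuous_imp_homeomorphic_map)

section \<open>The factor map\<close>

lemma continuous_map_Gamma_map: "continuous_map (torus k) euclidean (Gamma_map k lam)"
  unfolding euclidean_product_topology[symmetric] continuous_map_componentwise_UNIV Gamma_map_def
  by (intro allI continuous_map_torus_monomial order_refl)

lemma sum_binomial_power_eq:
  fixes n :: int
  shows "(\<Sum>i=j..j+m. int (m choose (i - j)) * n ^ (j + m - i)) = (n + 1) ^ m"
proof -
  have "(\<Sum>i=j..j+m. int (m choose (i - j)) * n ^ (j + m - i)) = (\<Sum>i\<le>m. int (m choose i) * n ^ (m - i))"
    by (rule sum.reindex_bij_witness[of _ "\<lambda>i. i + j" "\<lambda>i. i - j"]) (auto simp: add.commute)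
  also have "\<dots> = (1 + n) ^ m"
    by (simp add: binomial_ring)
  finally show ?thesis
    by (simp add: add.commute)
qed

text \<open>
  Compare exponents on both sides. After interchanging the products over \<open>j \<le> i\<close>, the exponent of
  \<open>x j\<close> in \<open>Gamma_map k lam (milnes_map k lam x) n\<close> is the binomial expansion of
  \<open>(n + 1) ^ (k - j)\<close>. The factors \<open>lam ^ (k choose i)\<close> supply in the same way all terms of
  \<open>(n + 1) ^ k\<close> except \<open>n ^ k\<close>, which comes from \<open>power_fun k lam n\<close>.
\<close>

lemma shift_Gamma_map:
  assumes "lam \<in> circle" "x \<in> topspace (torus k)"
  shows "shift (Gamma_map k lam x) = Gamma_map k lam (milnes_map k lam x)"
proof
  fix n :: int
  have lam0: "lam \<noteq> 0"
    using assms(1) by (rule circle_not_zero)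
  have x0: "x j \<noteq> 0" if "j \<in> {1..k}" for j
    using circle_not_zero torus_coordinate[OF assms(2) that] .
  have "(\<Prod>i=1..k. milnes_map k lam x i powi (n ^ (k - i))) =
      (\<Prod>i=1..k. lam powi (int (k choose i) * n ^ (k - i))) *
      (\<Prod>i=1..k. \<Prod>j=1..i. x j powi (int ((k - j) choose (i - j)) * n ^ (k - i)))"
    unfolding prod.distrib[symmetric]
    by (intro prod.cong refl)
      (simp add: milnes_map_def power_int_mult_distrib power_int_power power_int_prod_base)
  also have "(\<Prod>i=1..k. \<Prod>j=1..i. x j powi (int ((k - j) choose (i - j)) * n ^ (k - i))) =
      (\<Prod>j=1..k. \<Prod>i=j..k. x j powi (int ((k - j) choose (i - j)) * n ^ (k - i)))"
    unfolding prod.Sigma[OF finite_atLeastAtMost ballI[OF finite_atLeastAtMost]]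
    by (rule prod.reindex_bij_witness[of _ "\<lambda>(j, i). (i, j)" "\<lambda>(i, j). (j, i)"]) auto
  also have "\<dots> = (\<Prod>j=1..k. x j powi ((n + 1) ^ (k - j)))"
  proof (intro prod.cong refl)
    fix j assume j: "j \<in> {1..k}"
    have "(\<Sum>i=j..k. int ((k - j) choose (i - j)) * n ^ (k - i)) = (n + 1) ^ (k - j)"
      using sum_binomial_power_eq[where j = j and m = "k - j"] j by simp
    then show "(\<Prod>i=j..k. x j powi (int ((k - j) choose (i - j)) * n ^ (k - i))) = x j powi ((n + 1) ^ (k - j))"
      using power_int_sum_exponent[OF x0[OF j]] by metis
  qed
  also have "lam powi (n ^ k) * ((\<Prod>i=1..k. lam powi (int (k choose i) * n ^ (k - i))) * \<dots>) =
      lam powi ((n + 1) ^ k) * (\<Prod>j=1..k. x j powi ((n + 1) ^ (k - j)))"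
  proof -
    have "(\<Sum>i=0..k. int (k choose i) * n ^ (k - i)) = (n + 1) ^ k"
      using sum_binomial_power_eq[where j = 0 and m = k] by simp
    then have "(n + 1) ^ k = n ^ k + (\<Sum>i=1..k. int (k choose i) * n ^ (k - i))"
      by (simp add: sum.atLeast_Suc_atMost)
    then show ?thesis
      by (simp only: power_int_add lam0 power_int_sum_exponent[OF lam0] simp_thms mult.assoc not_False_eq_True)
  qed
  finally show "shift (Gamma_map k lam x) n = Gamma_map k lam (milnes_map k lam x) n"
    by (simp add: shift_def Gamma_map_def power_fun_def)
qed

lemma inv_shift: "inv shift = (\<lambda>g n. g (n - 1))"
  by (rule inv_equality) (auto simp: shift_def)

lemma int_iterate_shift: "int_iterate shift n g = (\<lambda>m. g (m + n))"
proof -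
  have "(shift ^^ i) g = (\<lambda>m. g (m + int i))" for i
    by (induction i) (auto simp: shift_def algebra_simps)
  moreover have "(inv shift ^^ i) g = (\<lambda>m. g (m - int i))" for i
    by (induction i) (auto simp: inv_shift algebra_simps)
  ultimately show ?thesis
    by (auto simp: int_iterate_def)
qed

text \<open>
  This is the binomial expansion of \<open>(n + m) ^ k\<close>, read as a function of \<open>m\<close>: it identifies the
  shift orbit of \<open>power_fun k lam\<close> with the image of a single orbit in the torus.
\<close>

lemma Gamma_map_orbit_point:
  assumes "lam \<in> circle"
  shows "Gamma_map k lam (orbit_point k lam n) = int_iterate shift n (power_fun k lam)"
proof
  fix m :: int
  have lam0: "lam \<noteq> 0"
    using assms(1) by (rule circle_not_zero)
  have "(n + m) ^ k = (\<Sum>j=0..k. int (k choose j) * n ^ j * m ^ (k - j))"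
    by (simp add: binomial_ring atMost_atLeast0)
  also have "\<dots> = m ^ k + (\<Sum>j=1..k. int (k choose j) * n ^ j * m ^ (k - j))"
    by (simp add: sum.atLeast_Suc_atMost)
  finally have "lam powi ((n + m) ^ k) =
      lam powi (m ^ k) * (\<Prod>j=1..k. lam powi (int (k choose j) * n ^ j * m ^ (k - j)))"
    using lam0 by (simp add: power_int_add power_int_sum_exponent)
  also have "(\<Prod>j=1..k. lam powi (int (k choose j) * n ^ j * m ^ (k - j))) =
      (\<Prod>j=1..k. orbit_point k lam n j powi (m ^ (k - j)))"
    by (intro prod.cong) (auto simp: orbit_point_def power_int_mult)
  finally show "Gamma_map k lam (orbit_point k lam n) m = int_iterate shift n (power_fun k lam) m"
    by (simp add: Gamma_map_def power_fun_def int_iterate_shift add.commute)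
qed

lemma Gamma_map_in_linf:
  assumes "lam \<in> circle" "x \<in> topspace (torus k)"
  shows "Gamma_map k lam x \<in> linf"
proof -
  have "norm (x j) = 1" if "j \<in> {1..k}" for j
    using torus_coordinate[OF assms(2) that] by simp
  then have "norm (Gamma_map k lam x n) = 1" for n
    using assms(1) by (simp add: Gamma_map_def power_fun_def norm_mult norm_power_int prod_norm[symmetric])
  then show ?thesis
    by (auto simp: linf_def bounded_iff intro!: exI[of _ 1])
qed

text \<open>
  The image is compact, hence closed, and contains the shift orbit, so it contains the orbit
  closure. Conversely, by density every point of the torus is a limit of orbit points, and
  continuity carries this over to the images.
\<close>

lemma Gamma_map_image_eq_orbit_closure:
  assumes lam: "lam \<in> circle" "irrational lam"
  shows "Gamma_map k lam ` topspace (torus k) = orbit_closure (power_fun k lam)"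
proof -
  have orbit: "{int_iterate shift n (power_fun k lam) |n. True} = Gamma_map k lam ` range (orbit_point k lam)"
    unfolding full_SetCompr_eq image_image Gamma_map_orbit_point[OF lam(1)] by auto
  have cont: "continuous_map (torus k) (top_of_set linf) (Gamma_map k lam)"
    using Gamma_map_in_linf[OF lam(1)] continuous_map_Gamma_map
    by (auto simp: continuous_map_in_subtopology)
  have "compact (Gamma_map k lam ` topspace (torus k))"
    using image_compactin[OF _ continuous_map_Gamma_map[of k lam]] compact_space_torus[of k]
    by (auto simp: compact_space_def)
  then have "closedin (top_of_set linf) (Gamma_map k lam ` topspace (torus k))"
    using Gamma_map_in_linf[OF lam(1)]
    by (intro closed_subset compact_imp_closed) auto
  then have "orbit_closure (power_fun k lam) \<subseteq> Gamma_map k lam ` topspace (torus k)"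
    unfolding orbit_closure_def orbit
    using orbit_point_in_torus[OF lam(1)] by (intro closure_of_minimal) auto
  moreover have "Gamma_map k lam ` topspace (torus k) \<subseteq> orbit_closure (power_fun k lam)"
    using continuous_map_image_closure_subset[OF cont, of "range (orbit_point k lam)"]
    unfolding torus_orbit_points_dense[OF lam] orbit_closure_def orbit .
  ultimately show ?thesis
    by blast
qed

lemma continuous_on_shift: "continuous_on A shift"
  unfolding shift_def by (intro continuous_on_coordinatewise_then_product
      continuous_on_subset[OF continuous_on_product_coordinates subset_UNIV])

text \<open>
  The shift is injective on all sequences; it maps the orbit closure onto itself because the orbit
  closure is a factor of the torus, on which \<open>milnes_map\<close> is onto. Compactness then makes it a
  homeomorphism.
\<close>

lemma dynamical_system_orbit_closure:
  assumes lam: "lam \<in> circle" "irrational lam"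
  shows "dynamical_system (top_of_set (orbit_closure (power_fun k lam))) shift"
proof -
  let ?X = "orbit_closure (power_fun k lam)"
  note range = Gamma_map_image_eq_orbit_closure[OF lam, of k, symmetric]
  have "shift ` ?X = Gamma_map k lam ` milnes_map k lam ` topspace (torus k)"
    unfolding range image_image using shift_Gamma_map[OF lam(1)] by (intro image_cong) auto
  then have image: "shift ` ?X = ?X"
    unfolding milnes_map_image_torus[OF lam(1)] range .
  have "compact ?X"
    unfolding range using image_compactin[OF _ continuous_map_Gamma_map[of k lam]] compact_space_torus[of k]
    by (auto simp: compact_space_def)
  then have "compact_space (top_of_set ?X)"
    by (simp add: compact_space_subtopology)
  moreover have "Hausdorff_space (top_of_set ?X)"
    by (simp add: Hausdorff_space_subtopology)
  moreover have "inj_on shift ?X"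
  proof (rule inj_onI)
    fix g h assume "shift g = shift h"
    then have "g ((n - 1) + 1) = h ((n - 1) + 1)" for n
      unfolding shift_def by metis
    then show "g = h"
      by auto
  qed
  moreover have "continuous_map (top_of_set ?X) (top_of_set ?X) shift"
    using image continuous_on_shift by (auto simp: continuous_map_in_subtopology)
  ultimately show ?thesis
    unfolding dynamical_system_def using image by (auto intro!: continuous_imp_homeomorphic_map)
qed

theorem theorem5p3:
  fixes k :: nat and lam :: complex
  assumes "1 \<le> k" and "lam \<in> circle" and "irrational lam"
  shows "Gamma_map k lam ` topspace (torus k) = orbit_closure (power_fun k lam) \<and>
    dyn_homomorphism (torus k) (milnes_map k lam)
      (top_of_set (orbit_closure (power_fun k lam))) shift (Gamma_map k lam) \<and>
    is_factor (top_of_set (orbit_closure (power_fun k lam))) shift (torus k) (milnes_map k lam)"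
proof -
  let ?X = "orbit_closure (power_fun k lam)"
  have range: "Gamma_map k lam ` topspace (torus k) = ?X"
    using assms by (intro Gamma_map_image_eq_orbit_closure)
  then have "continuous_map (torus k) (top_of_set ?X) (Gamma_map k lam)"
    using continuous_map_Gamma_map by (auto simp: continuous_map_in_subtopology)
  then have "dyn_homomorphism (torus k) (milnes_map k lam) (top_of_set ?X) shift (Gamma_map k lam)"
    unfolding dyn_homomorphism_def
    using dynamical_system_torus dynamical_system_orbit_closure shift_Gamma_map assms by blast
  moreover from this have "is_factor (top_of_set ?X) shift (torus k) (milnes_map k lam)"
    unfolding is_factor_def using range by auto
  ultimately show ?thesis
    using range by blast
qed

end
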